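(* Let $7 \le p \le q$ and let $D$ be a strong orientation of $K(3,p,q)$ with diameter two, with parts $V_1=\{x_1,x_2,x_3\}$, $V_2$ ($|V_2|=p$), $V_3$ ($|V_3|=q$). Then it is not the case that exactly seven of the eight sets $V_2^A$ ($A \subseteq \{1,2,3\}$) are nonempty.
   Context: $K(3,p,q)$ is the complete tripartite graph with parts $V_1=\{x_1,x_2,x_3\}$, $V_2$ of size $p$, $V_3$ of size $q$. A strong orientation is an orientation of all edges making the digraph strongly connected; its diameter is the maximum directed distance between ordered pairs of vertices. Write $u\to v$ if the edge $uv$ is oriented from $u$ to $v$. For $A \subseteq [3]=\{1,2,3\}$, let $N_D^A$ be the set of vertices $w$ such that $x_i \to w$ for all $i \in A$ and $w \to x_j$ for all $j \in [3]\setminus A$, and $V_2^A = V_2 \cap N_D^A$. The eight sets $V_2^A$ partition $V_2$. *)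

theory Defs
  imports "Graph_Theory.Graph_Theory"
begin

text \<open>
  Following the \<^verbatim>\<open>Graph_Theory\<close> entry, an undirected graph is a symmetric digraph, that is,
  each edge is present as a pair of opposite arcs. Parts are meant to be finite and pairwise
  disjoint.
\<close>

definition complete_tripartite :: "'a set \<Rightarrow> 'a set \<Rightarrow> 'a set \<Rightarrow> 'a pair_pre_digraph" where
  "complete_tripartite V\<^sub>1 V\<^sub>2 V\<^sub>3 =
     \<lparr> pverts = V\<^sub>1 \<union> V\<^sub>2 \<union> V\<^sub>3,
       parcs = V\<^sub>1 \<times> V\<^sub>2 \<union> V\<^sub>2 \<times> V\<^sub>1 \<union> V\<^sub>1 \<times> V\<^sub>3 \<union> V\<^sub>3 \<times> V\<^sub>1 \<union> V\<^sub>2 \<times> V\<^sub>3 \<union> V\<^sub>3 \<times> V\<^sub>2 \<rparr>"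

lemma pair_graph_complete_tripartite:
  assumes "finite V\<^sub>1" "finite V\<^sub>2" "finite V\<^sub>3"
    and "V\<^sub>1 \<inter> V\<^sub>2 = {}" "V\<^sub>1 \<inter> V\<^sub>3 = {}" "V\<^sub>2 \<inter> V\<^sub>3 = {}"
  shows "pair_graph (complete_tripartite V\<^sub>1 V\<^sub>2 V\<^sub>3)"
  using assms
  by unfold_locales (auto simp: complete_tripartite_def symmetric_def intro!: symI)

text \<open>Exactly one of the two arcs representing an edge of \<open>G\<close> is kept.\<close>

definition orientation :: "'a pair_pre_digraph \<Rightarrow> 'a pair_pre_digraph \<Rightarrow> bool" where
  "orientation D G \<longleftrightarrow>
     pverts D = pverts G \<and> parcs D \<subseteq> parcs G \<and>
     (\<forall>(u, v) \<in> parcs G. (u, v) \<in> parcs D \<longleftrightarrow> (v, u) \<notin> parcs D)"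

definition strong_orientation :: "'a pair_pre_digraph \<Rightarrow> 'a pair_pre_digraph \<Rightarrow> bool" where
  "strong_orientation D G \<longleftrightarrow> orientation D G \<and> strongly_connected (with_proj D)"

text \<open>
  The least number of arcs on a directed walk from \<open>u\<close> to \<open>v\<close>: the shortest-path length for unit
  arc weights, which is \<open>\<infinity>\<close> if \<open>v\<close> is not reachable from \<open>u\<close>.
\<close>

definition directed_dist :: "'a pair_pre_digraph \<Rightarrow> 'a \<Rightarrow> 'a \<Rightarrow> ereal" where
  "directed_dist D u v = wf_digraph.\<mu> (with_proj D) (\<lambda>_. 1) u v"

text \<open>For a finite nonempty vertex set the supremum is a maximum.\<close>

definition directed_diameter :: "'a pair_pre_digraph \<Rightarrow> ereal" where
  "directed_diameter D = (SUP (u, v) \<in> pverts D \<times> pverts D. directed_dist D u v)"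

text \<open>
  The set \<open>N\<^sub>D\<^sup>A\<close> for \<open>A \<subseteq> {1, 2, 3}\<close>, where \<open>x\<close> enumerates the part \<open>V\<^sub>1 = {x 1, x 2, x 3}\<close>.
\<close>

definition nbr_class :: "'a pair_pre_digraph \<Rightarrow> (nat \<Rightarrow> 'a) \<Rightarrow> nat set \<Rightarrow> 'a set" where
  "nbr_class D x A =
     {w \<in> pverts D. (\<forall>i \<in> A. x i \<rightarrow>\<^bsub>with_proj D\<^esub> w) \<and> (\<forall>j \<in> {1, 2, 3} - A. w \<rightarrow>\<^bsub>with_proj D\<^esub> x j)}"

end

theory Submission
  imports Defs
begin

text \<open>
  If \<open>u \<in> V\<^sub>2\<close> and \<open>w \<in> V\<^sub>3\<close> lay in the same class \<open>N\<^sub>D\<^sup>A\<close>, no path of length two through \<open>V\<^sub>1\<close> would join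
  them, so they could not be at distance at most two in both directions. Hence, if \<open>V\<^sub>2\<close> meets
  seven classes, all of \<open>V\<^sub>3\<close> lies in the eighth, so \<open>x\<^sub>1\<close> is joined to all of \<open>V\<^sub>3\<close> in one and
  the same direction. A vertex of \<open>V\<^sub>2\<close> joined to \<open>x\<^sub>1\<close> in that direction exists, but a path of length
  two closing its arc to a triangle would have to pass through \<open>V\<^sub>3\<close> against this direction.
\<close>

text \<open>A distance below 3 is witnessed by a walk with at most two arcs;
  \<open>u \<noteq> v\<close> rules out the empty walk and the missing arc rules out a single
  one.\<close>

lemma two_step_path:
  assumes wf: "wf_digraph (with_proj D)"
    and diam: "directed_diameter D \<le> 2"
    and uv: "u \<in> pverts D" "v \<in> pverts D" "u \<noteq> v" "(u, v) \<notin> parcs D"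
  obtains w where "(u, w) \<in> parcs D" "(w, v) \<in> parcs D"
proof -
  interpret wf_digraph "with_proj D" by (rule wf)
  have "directed_dist D u v \<le> directed_diameter D"
    unfolding directed_diameter_def using uv by (intro SUP_upper2[where i = "(u, v)"]) auto
  \<comment> \<open>The distance is an infimum over walks; the strict bound by the next integer
    makes some walk stay below it.\<close>
  also have "\<dots> < ereal 3"
    by (rule le_less_trans[OF diam]) simp
  finally obtain p where p: "awalk u p v" "awalk_cost (\<lambda>_. 1) p < 3"
    unfolding directed_dist_def \<mu>_def by (auto simp: INF_less_iff)
  have "awalk_cost (\<lambda>_. 1) es = length es" for es :: "('a \<times> 'a) list"
    by (induction es) auto
  with p(2) have "length p < 3" by simp
  then consider "p = []" | e where "p = [e]" | e e' where "p = [e, e']"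
    by (cases p rule: list.exhaust; cases "tl p" rule: list.exhaust; cases "tl (tl p)") auto
  then show thesis
  proof cases
    case 1
    with p(1) uv(3) show thesis by (simp add: awalk_Nil_iff)
  next
    case (2 e)
    with p(1) have "e = (u, v)" "e \<in> parcs D"
      by (auto simp: awalk_simps prod_eq_iff)
    with uv(4) show thesis by simp
  next
    case (3 e e')
    with p(1) have "e = (u, snd e)" "e' = (snd e, v)" "e \<in> parcs D" "e' \<in> parcs D"
      by (auto simp: awalk_simps prod_eq_iff)
    then show thesis using that[of "snd e"] by metis
  qed
qed

lemma wf_digraph_orientation:
  assumes "orientation D (complete_tripartite V\<^sub>1 V\<^sub>2 V\<^sub>3)"
  shows "wf_digraph (with_proj D)"
  using assms by unfold_locales (auto simp: orientation_def complete_tripartite_def)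

theorem theorem4p23:
  fixes D :: "'a pair_pre_digraph" and x :: "nat \<Rightarrow> 'a"
    and V\<^sub>1 V\<^sub>2 V\<^sub>3 :: "'a set" and p q :: nat
  assumes "7 \<le> p" and "p \<le> q"
    and "V\<^sub>1 = {x 1, x 2, x 3}" and "inj_on x {1, 2, 3}"
    and "finite V\<^sub>2" and "card V\<^sub>2 = p"
    and "finite V\<^sub>3" and "card V\<^sub>3 = q"
    and "V\<^sub>1 \<inter> V\<^sub>2 = {}" and "V\<^sub>1 \<inter> V\<^sub>3 = {}" and "V\<^sub>2 \<inter> V\<^sub>3 = {}"
    and "strong_orientation D (complete_tripartite V\<^sub>1 V\<^sub>2 V\<^sub>3)"
    and "directed_diameter D = 2"
  shows "card {A. A \<subseteq> {1, 2, 3} \<and> V\<^sub>2 \<inter> nbr_class D x A \<noteq> {}} \<noteq> 7"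
proof
  let ?S = "{A. A \<subseteq> {1, 2, 3} \<and> V\<^sub>2 \<inter> nbr_class D x A \<noteq> {}}"
  let ?E = "parcs D"
  assume card_S: "card ?S = 7"
  have ori: "orientation D (complete_tripartite V\<^sub>1 V\<^sub>2 V\<^sub>3)"
    using assms(12) by (simp add: strong_orientation_def)
  have verts: "pverts D = V\<^sub>1 \<union> V\<^sub>2 \<union> V\<^sub>3"
    using ori by (simp add: orientation_def complete_tripartite_def)
  have edges: "?E \<subseteq> V\<^sub>1 \<times> V\<^sub>2 \<union> V\<^sub>2 \<times> V\<^sub>1 \<union> V\<^sub>1 \<times> V\<^sub>3 \<union> V\<^sub>3 \<times> V\<^sub>1 \<union> V\<^sub>2 \<times> V\<^sub>3 \<union> V\<^sub>3 \<times> V\<^sub>2"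
    using ori by (simp add: orientation_def complete_tripartite_def)
  have asym: "(v, u) \<notin> ?E" if "(u, v) \<in> ?E" for u v
    using ori that unfolding orientation_def by blast
  have total: "(u, v) \<in> ?E \<or> (v, u) \<in> ?E"
    if "(u, v) \<in> V\<^sub>1 \<times> V\<^sub>3 \<union> V\<^sub>2 \<times> V\<^sub>3" for u v
    using ori that unfolding orientation_def complete_tripartite_def by fastforce
  have x_in: "x i \<in> V\<^sub>1" if "i \<in> {1, 2, 3}" for i
    using that assms(3) by auto
  note disjoint = assms(9-11)
  \<comment> \<open>Every arc lies on a directed triangle: its reverse is absent, so the way back
    takes two arcs.\<close>
  have mid: "\<exists>w. (u, w) \<in> ?E \<and> (w, v) \<in> ?E"
    if "u \<in> pverts D" "v \<in> pverts D" "(v, u) \<in> ?E" for u v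
  proof -
    have "(u, v) \<notin> ?E" "u \<noteq> v" using asym that(3) by blast+
    then show ?thesis
      using two_step_path[OF wf_digraph_orientation[OF ori] _ that(1,2)] assms(13) by auto
  qed

  \<comment> \<open>For \<open>w\<close> in \<open>V\<^sub>3\<close>, this is the index of the class
    containing \<open>w\<close>.\<close>
  let ?T = "\<lambda>w. {i \<in> {1, 2, 3}. (x i, w) \<in> ?E}"
  have T_notin: "?T w \<notin> ?S" if w: "w \<in> V\<^sub>3" for w
  proof
    assume "?T w \<in> ?S"
    then obtain u where u: "u \<in> V\<^sub>2"
      and "\<forall>i \<in> ?T w. (x i, u) \<in> ?E" "\<forall>i \<in> {1, 2, 3} - ?T w. (u, x i) \<in> ?E"
      by (auto simp: nbr_class_def)
    then have u_w: "(x i, u) \<in> ?E \<longleftrightarrow> (x i, w) \<in> ?E" if "i \<in> {1, 2, 3}" for i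
      using that asym by blast
    \<comment> \<open>A midpoint would be some \<open>x i\<close>, which by \<open>u_w\<close> has
      arcs to both \<open>u\<close> and \<open>w\<close> or to neither.\<close>
    have not_mid: "\<not> ((a, z) \<in> ?E \<and> (z, b) \<in> ?E)"
      if ab: "(a, b) = (u, w) \<or> (a, b) = (w, u)" for a b z
    proof
      assume z: "(a, z) \<in> ?E \<and> (z, b) \<in> ?E"
      then have "z \<in> V\<^sub>1" using edges ab u w disjoint by blast
      then obtain i where "i \<in> {1, 2, 3}" "z = x i" using assms(3) by blast
      with u_w z ab asym show False by blast
    qed
    have "u \<in> pverts D" "w \<in> pverts D" using u w verts by auto
    then show False
      using mid[of u w] mid[of w u] total[of u w] not_mid u w by blast
  qed

  have "card (Pow {1, 2, 3 :: nat} - ?S) = card (Pow {1, 2, 3 :: nat}) - card ?S"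
    by (intro card_Diff_subset finite_subset[of ?S "Pow {1, 2, 3}"]) auto
  also have "\<dots> = 1" using card_S by (simp add: card_Pow)
  finally obtain B where B: "Pow {1, 2, 3} - ?S = {B}"
    by (auto simp: card_1_singleton_iff)
  then have in_S: "A \<in> ?S" if "A \<subseteq> {1, 2, 3}" "A \<noteq> B" for A
    using that by blast
  have T_eq: "?T w = B" if "w \<in> V\<^sub>3" for w
  proof -
    have "?T w \<in> Pow {1, 2, 3} - ?S" using T_notin[OF that] by blast
    then show ?thesis unfolding B by blast
  qed

  \<comment> \<open>Arcs stay within no part, so a midpoint between \<open>x 1\<close> and a vertex
    of \<open>V\<^sub>2\<close> lies in the third part.\<close>
  have via_V3: "z \<in> V\<^sub>3"
    if "v \<in> V\<^sub>2" "(x 1, z) \<in> ?E \<and> (z, v) \<in> ?E \<or> (v, z) \<in> ?E \<and> (z, x 1) \<in> ?E" for v z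
  proof -
    have "z \<in> V\<^sub>2 \<union> V\<^sub>3" using that(2) edges x_in[of 1] disjoint by auto
    moreover have "z \<notin> V\<^sub>2" using that edges disjoint by auto
    ultimately show ?thesis by blast
  qed
  have x1: "x 1 \<in> pverts D" using x_in[of 1] verts by simp
  show False
  proof (cases "1 \<in> B")
    case True
    \<comment> \<open>Two candidates are offered since either one may be \<open>B\<close>.\<close>
    obtain A where "A \<subseteq> {1, 2, 3}" "1 \<in> A" "A \<noteq> B"
      using that[of "{1}"] that[of "{1, 2}"] by fastforce
    then obtain v where v: "v \<in> V\<^sub>2" "(x 1, v) \<in> ?E"
      using in_S[of A] by (auto simp: nbr_class_def)
    then obtain z where z: "(v, z) \<in> ?E" "(z, x 1) \<in> ?E"
      using mid[OF _ x1, of v] verts by blast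
    then have "?T z = B" using T_eq via_V3 v by blast
    with True z(2) asym show False by blast
  next
    case False
    obtain A where "A \<subseteq> {1, 2, 3}" "1 \<notin> A" "A \<noteq> B"
      using that[of "{}"] that[of "{2}"] by fastforce
    then obtain v where v: "v \<in> V\<^sub>2" "(v, x 1) \<in> ?E"
      using in_S[of A] by (auto simp: nbr_class_def simp del: One_nat_def)
    \<comment> \<open>Here \<open>x 1 \<rightarrow> z\<close> puts 1 into \<open>?T z\<close>, which
      equals \<open>B\<close>.\<close>
    then obtain z where z: "(x 1, z) \<in> ?E" "(z, v) \<in> ?E"
      using mid[OF x1, of v] verts by blast
    then have "?T z = B" using T_eq via_V3 v by blast
    with False z(1) show False by blast
  qed
qed

end
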